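(* Let $M\ge 1$ be an integer, $N=2M-1$, $\sigma>0$, and let $s\sim\mathcal{N}(0,\sigma^2)$ be a real Gaussian random variable. Let $A$ and $B$ be the $M\times M$ Hankel matrices $$A_{ij}=E\big(s^{2(i+j-2)}\big),\qquad B_{ij}=E\big(s^{2(i+j-1)}\big),\qquad 1\le i,j\le M,$$ and let $D=\operatorname{diag}(1,3,5,\dots,N)$, $D_\sigma=\operatorname{diag}(1,\sigma^2,\sigma^4,\dots,\sigma^{N-1})$. Let $L_b$ be the $M\times M$ lower-triangular matrix whose rows are, from top to bottom, the Hermite coefficient vectors $\beta_{1,N},\beta_{3,N},\dots,\beta_{N,N}$, and let $L_a$ be the $M\times M$ lower-triangular matrix whose rows are, from top to bottom, $\beta_{0,N},\beta_{2,N},\dots,\beta_{N-1,N}$. Then $$L_bD_\sigma^{-1}BD_\sigma^{-1}L_b^{T}=\sigma^2D_b,\qquad L_aD_\sigma^{-1}AD_\sigma^{-1}L_a^{T}=D_a,$$ where $$D_a=\operatorname{diag}(1,2!,4!,\dots,(N-1)!),\qquad D_b=\operatorname{diag}(1,3!,5!,\dots,N!)=DD_a.$$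
   Context: The Hermite polynomials are $H_n(x)=(-1)^n e^{x^2/2}\frac{d^n}{dx^n}e^{-x^2/2}$ for $n\ge 0$ (so $H_0=1$, $H_1=x$, $H_2=x^2-1$, $H_3=x^3-3x$). Let $z(x)=(1,x^2,x^4,\dots,x^{N-1})$, a row vector of length $M$. For $1\le m\le M$, the row vectors $\beta_{2m-1,N},\beta_{2m-2,N}\in\mathbb{R}^M$ are defined by the polynomial identities $H_{2m-1}(x)=x\,\beta_{2m-1,N}\,z(x)^{T}$ and $H_{2m-2}(x)=\beta_{2m-2,N}\,z(x)^{T}$. For example, $\beta_{3,N}=(-3,1,0,\dots,0)$ and $\beta_{4,N}=(3,-6,1,0,\dots,0)$ (when $M$ is large enough for these to be defined). $E(\cdot)$ denotes expectation. *)

theory Defs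
  imports
    "HOL-Probability.Probability"
    "HOL-Computational_Algebra.Polynomial"
    "Jordan_Normal_Form.Matrix"
    "Jordan_Normal_Form.Gauss_Jordan_Elimination"
begin

hide_type (open) Finite_Cartesian_Product.vec
hide_const (open) Finite_Cartesian_Product.vec Finite_Cartesian_Product.mat
unbundle no vec_syntax and no inner_syntax

definition hermite :: "nat \<Rightarrow> real \<Rightarrow> real" where
  "hermite n x = (-1) ^ n * exp (x\<^sup>2 / 2) * (deriv ^^ n) (\<lambda>t. exp (- t\<^sup>2 / 2)) x"

definition even_powers :: "nat \<Rightarrow> real \<Rightarrow> real vec" where
  "even_powers M x = vec M (\<lambda>k. x ^ (2 * k))"

text \<open>The vector \<open>hermite_vec M n\<close> (written \<open>\<beta>\<^bsub>n,N\<^esub>\<close> with \<open>N = 2 M - 1\<close> in the literature) is defined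
  by a polynomial identity. It is meaningful only for \<open>n < 2 M\<close>; see \<open>ex1_hermite_vec\<close> below.\<close>

definition is_hermite_vec :: "nat \<Rightarrow> nat \<Rightarrow> real vec \<Rightarrow> bool" where
  "is_hermite_vec M n v \<longleftrightarrow> v \<in> carrier_vec M \<and>
     (\<forall>x. hermite n x = (if odd n then x * (v \<bullet> even_powers M x) else v \<bullet> even_powers M x))"

definition hermite_vec :: "nat \<Rightarrow> nat \<Rightarrow> real vec" where
  "hermite_vec M n = (THE v. is_hermite_vec M n v)"

lemma hermite_poly:
  "\<exists>p :: real poly. (\<forall>x. hermite n x = poly p x) \<and> degree p \<le> n \<and> (\<forall>k. odd (n + k) \<longrightarrow> coeff p k = 0)"
proof -
  let ?g = "\<lambda>t::real. exp (- t\<^sup>2 / 2)"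
  have "\<exists>p :: real poly. (deriv ^^ n) ?g = (\<lambda>x. (-1) ^ n * poly p x * ?g x) \<and> degree p \<le> n
          \<and> (\<forall>k. odd (n + k) \<longrightarrow> coeff p k = 0)"
  proof (induction n)
    case 0
    show ?case
      by (rule exI[of _ 1]) (auto simp: odd_pos)
  next
    case (Suc n)
    then obtain p :: "real poly" where p: "(deriv ^^ n) ?g = (\<lambda>x. (-1) ^ n * poly p x * ?g x)"
      "degree p \<le> n" "\<And>k. odd (n + k) \<Longrightarrow> coeff p k = 0" by blast
    let ?q = "pCons 0 p - pderiv p"
    have "deriv (\<lambda>x. (-1) ^ n * poly p x * ?g x) x = (-1) ^ Suc n * poly ?q x * ?g x" for x
      by (rule DERIV_imp_deriv)
         (auto intro!: derivative_eq_intros simp: algebra_simps)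
    then have "(deriv ^^ Suc n) ?g = (\<lambda>x. (-1) ^ Suc n * poly ?q x * ?g x)"
      unfolding funpow.simps o_apply p(1) by (rule ext)
    moreover have "degree ?q \<le> Suc n"
      using p(2) by (intro degree_diff_le) (auto simp: degree_pderiv degree_pCons_eq_if)
    moreover have "\<forall>k. odd (Suc n + k) \<longrightarrow> coeff ?q k = 0"
      using p(3) by (auto simp: coeff_pderiv coeff_pCons split: nat.splits)
    ultimately show ?case by blast
  qed
  then obtain p :: "real poly" where p: "(deriv ^^ n) ?g = (\<lambda>x. (-1) ^ n * poly p x * ?g x)"
    "degree p \<le> n" "\<forall>k. odd (n + k) \<longrightarrow> coeff p k = 0" by blast
  have "hermite n x = poly p x" for x
  proof -
    have "hermite n x = ((-1) ^ n * (-1) ^ n) * poly p x * (exp (x\<^sup>2 / 2) * ?g x)"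
      unfolding hermite_def p(1) by simp
    then show ?thesis by (simp flip: exp_add power_mult_distrib)
  qed
  then show ?thesis using p by blast
qed

lemma even_powers_inner_inject:
  assumes "v \<in> carrier_vec M" "w \<in> carrier_vec M"
    and eq: "\<And>x. x > 0 \<Longrightarrow> v \<bullet> even_powers M x = w \<bullet> even_powers M x"
  shows "v = w"
proof -
  define P where "P = (\<Sum>k<M. monom (v $ k - w $ k) k)"
  have "poly P y = 0" if "y > 0" for y
    using eq[of "sqrt y"] that
    by (simp add: P_def poly_sum poly_monom even_powers_def scalar_prod_def power_mult
        left_diff_distrib sum_subtractf atLeast0LessThan)
  then have "{0<..} \<subseteq> {y. poly P y = 0}" by auto
  then have "P = 0"
    using poly_roots_finite[of P] infinite_Ioi[of "0::real"] finite_subset by blast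
  moreover have "coeff P k = v $ k - w $ k" if "k < M" for k
    using that by (simp add: P_def coeff_sum)
  ultimately have "v $ k = w $ k" if "k < M" for k
    using that by simp
  then show ?thesis using assms(1,2) by (intro eq_vecI) auto
qed

lemma ex1_hermite_vec:
  assumes "n < 2 * M"
  shows "\<exists>!v. is_hermite_vec M n v"
proof (rule ex_ex1I)
  obtain p :: "real poly" where p: "\<And>x. hermite n x = poly p x" "degree p \<le> n"
    "\<And>k. odd (n + k) \<Longrightarrow> coeff p k = 0" using hermite_poly by blast
  let ?v = "vec M (\<lambda>k. coeff p (if odd n then 2 * k + 1 else 2 * k))"
  have split: "(\<Sum>k<2 * m. f k) = (\<Sum>k<m. f (2 * k) + f (2 * k + 1))" for f :: "nat \<Rightarrow> real" and m
    by (induction m) (auto simp: algebra_simps)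
  have "hermite n x = (if odd n then x * (?v \<bullet> even_powers M x) else ?v \<bullet> even_powers M x)" for x
  proof -
    have "hermite n x = (\<Sum>k<2 * M. coeff p k * x ^ k)"
      unfolding p(1) poly_altdef
      by (rule sum.mono_neutral_left) (use p(2) assms in \<open>auto simp: coeff_eq_0\<close>)
    also have "\<dots> = (\<Sum>k<M. coeff p (2 * k) * x ^ (2 * k) + coeff p (2 * k + 1) * x ^ (2 * k + 1))"
      by (rule split)
    finally show ?thesis
      by (auto simp: p(3) even_powers_def scalar_prod_def sum_distrib_left atLeast0LessThan mult_ac
          intro!: sum.cong)
  qed
  then have "is_hermite_vec M n ?v" by (simp add: is_hermite_vec_def)
  then show "\<exists>v. is_hermite_vec M n v" by blast
next
  fix v w assume vw: "is_hermite_vec M n v" "is_hermite_vec M n w"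
  show "v = w"
  proof (rule even_powers_inner_inject)
    show "v \<in> carrier_vec M" "w \<in> carrier_vec M" using vw by (auto simp: is_hermite_vec_def)
    fix x :: real assume "x > 0"
    with vw have "x * (v \<bullet> even_powers M x) = x * (w \<bullet> even_powers M x)" if "odd n"
      using that unfolding is_hermite_vec_def by metis
    moreover have "v \<bullet> even_powers M x = w \<bullet> even_powers M x" if "even n"
      using vw that unfolding is_hermite_vec_def by metis
    ultimately show "v \<bullet> even_powers M x = w \<bullet> even_powers M x"
      using \<open>x > 0\<close> by auto
  qed
qed

end

theory Submission
  imports Defs
begin

text \<open>
  Write \<open>E p\<close> for the expectation of \<open>p(Z)\<close> with \<open>Z\<close> standard normal. Stein's identity
  \<open>E (x p) = E (p')\<close> and the recursion \<open>He\<^bsub>n+1\<^esub> = x He\<^bsub>n\<^esub> - He\<^bsub>n\<^esub>'\<close> give \<open>E (He\<^bsub>n\<^esub> q) = E (q\<^bsup>(n)\<^esup>)\<close>,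
  whence \<open>E (He\<^bsub>m\<^esub> He\<^bsub>n\<^esub>)\<close> is \<open>n!\<close> or \<open>0\<close>. Scaling by \<open>D\<^bsub>\<sigma>\<^esub>\<close> turns the Hankel matrices into
  moment matrices of \<open>Z\<close>, and both matrix identities are this orthogonality relation, for odd and
  even indices, written in coefficients.
\<close>

subsection \<open>Hermite polynomials\<close>

text \<open>Differentiating \<open>p * exp (- x^2 / 2)\<close> turns the polynomial factor into
  \<open>p' - x p\<close>; the sign \<open>(-1) ^ n\<close> in \<open>hermite\<close> reverses this
  to \<open>x p - p'\<close>.\<close>

primrec hermite_p :: "nat \<Rightarrow> real poly" where
  "hermite_p 0 = 1"
| "hermite_p (Suc n) = pCons 0 (hermite_p n) - pderiv (hermite_p n)"

lemma hermite_eq_poly: "hermite n x = poly (hermite_p n) x"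
proof -
  let ?g = "\<lambda>t::real. exp (- t\<^sup>2 / 2)"
  have higher_deriv: "(deriv ^^ n) ?g = (\<lambda>x. (-1) ^ n * poly (hermite_p n) x * ?g x)"
  proof (induction n)
    case (Suc n)
    have "deriv (\<lambda>x. (-1) ^ n * poly (hermite_p n) x * ?g x) x =
        (-1) ^ Suc n * poly (hermite_p (Suc n)) x * ?g x" for x
      by (rule DERIV_imp_deriv) (auto intro!: derivative_eq_intros simp: algebra_simps)
    then show ?case
      unfolding funpow.simps o_apply Suc by (rule ext)
  qed simp
  have "hermite n x = ((-1) ^ n * (-1) ^ n) * poly (hermite_p n) x * (exp (x\<^sup>2 / 2) * ?g x)"
    unfolding hermite_def higher_deriv by simp
  then show ?thesis by (simp flip: exp_add power_mult_distrib)
qed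

lemma degree_hermite_p_le: "degree (hermite_p n) \<le> n"
proof (induction n)
  case (Suc n)
  then show ?case
    by (auto intro!: degree_diff_le simp: degree_pderiv degree_pCons_eq_if)
qed simp

lemma coeff_hermite_p_self: "coeff (hermite_p n) n = 1"
proof (induction n)
  case (Suc n)
  then show ?case
    using degree_hermite_p_le[of n] by (simp add: coeff_pderiv coeff_eq_0)
qed simp

lemma higher_pderiv_degree_le:
  fixes p :: "'a :: {comm_semiring_1,semiring_no_zero_divisors,semiring_char_0} poly"
  assumes "degree p \<le> n"
  shows "(pderiv ^^ n) p = [:fact n * coeff p n:]"
proof (rule poly_eqI)
  fix k
  show "coeff ((pderiv ^^ n) p) k = coeff [:fact n * coeff p n:] k"
    using assms by (cases k) (auto simp: coeff_higher_pderiv pochhammer_fact coeff_eq_0)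
qed

subsection \<open>Gaussian expectation of polynomials\<close>

text \<open>With a \<open>poly\<close> as argument, linearity holds without integrability
  conditions, and \<open>pderiv\<close> can be used in place of analytic derivatives.\<close>

definition gauss_E :: "real poly \<Rightarrow> real" where
  "gauss_E p = (\<integral>x. std_normal_density x * poly p x \<partial>lborel)"

lemma integrable_std_normal_poly: "integrable lborel (\<lambda>x. std_normal_density x * poly p x)"
proof -
  have "integrable lborel (\<lambda>x. \<Sum>i\<le>degree p. coeff p i * (std_normal_density x * x ^ i))"
    by (intro Bochner_Integration.integrable_sum integrable_mult_right
        integrable_std_normal_moment)
  also have "(\<lambda>x. \<Sum>i\<le>degree p. coeff p i * (std_normal_density x * x ^ i)) =
      (\<lambda>x. std_normal_density x * poly p x)"
    by (simp add: poly_altdef sum_distrib_left mult_ac)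
  finally show ?thesis .
qed

lemma gauss_E_add: "gauss_E (p + q) = gauss_E p + gauss_E q"
  by (simp add: gauss_E_def distrib_left integrable_std_normal_poly)

lemma gauss_E_smult: "gauss_E (Polynomial.smult c p) = c * gauss_E p"
  by (simp add: gauss_E_def mult.left_commute[of _ c])

lemma gauss_E_0: "gauss_E 0 = 0"
  by (simp add: gauss_E_def)

lemma gauss_E_diff: "gauss_E (p - q) = gauss_E p - gauss_E q"
  by (simp add: gauss_E_def right_diff_distrib integrable_std_normal_poly)

lemma gauss_E_sum: "gauss_E (\<Sum>i\<in>I. p i) = (\<Sum>i\<in>I. gauss_E (p i))"
  by (induction I rule: infinite_finite_induct) (simp_all add: gauss_E_0 gauss_E_add)

lemma gauss_E_monom: "gauss_E (monom c n) = c * gauss_E (monom 1 n)"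
  by (metis gauss_E_smult mult.right_neutral smult_monom)

lemma gauss_E_monom_even: "gauss_E (monom 1 (2 * k)) = fact (2 * k) / (2 ^ k * fact k)"
  by (simp add: gauss_E_def poly_monom integral_std_normal_moment_even)

lemma gauss_E_monom_odd: "gauss_E (monom 1 (Suc (2 * k))) = 0"
  using integral_std_normal_moment_odd[of k] by (simp add: gauss_E_def poly_monom)

lemma gauss_E_const: "gauss_E [:c:] = c"
  using gauss_E_monom[of c 0] gauss_E_monom_even[of 0] by (simp add: monom_0)

text \<open>Stein's identity on monomials is read off from the known moments, without integration by
  parts: odd moments vanish, and each even moment is the previous one times the next odd
  number.\<close>

lemma gauss_E_monom_Suc: "gauss_E (monom 1 (Suc n)) = gauss_E (pderiv (monom 1 n))"
proof (cases "even n")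
  case True
  then obtain k where n: "n = 2 * k" by (auto elim: evenE)
  show ?thesis
  proof (cases k)
    case 0
    then show ?thesis
      using gauss_E_monom_odd[of 0] by (simp add: n pderiv_monom gauss_E_0)
  next
    case (Suc j)
    then show ?thesis
      using gauss_E_monom_odd[of k] gauss_E_monom_odd[of j]
      \<comment> \<open>The pattern \<open>_ + _\<close> matches the coefficient that
        \<open>pderiv\<close> produces; on coefficient \<open>1\<close> the equation would rewrite
        forever.\<close>
      by (simp add: n pderiv_monom gauss_E_monom[of "_ + _"])
  qed
next
  case False
  then obtain k where n: "n = 2 * k + 1" by (auto elim: oddE)
  have "gauss_E (monom 1 (2 * Suc k)) = real (2 * k + 1) * gauss_E (monom 1 (2 * k))"
    unfolding gauss_E_monom_even by (simp add: divide_simps)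
  then show ?thesis
    by (simp add: n pderiv_monom gauss_E_monom[of "1 + _"])
qed

text \<open>Both sides are linear in \<open>p\<close>, so the monomial case suffices.\<close>

lemma stein_identity: "gauss_E (pCons 0 p) = gauss_E (pderiv p)"
proof -
  have "pCons 0 p = (\<Sum>i\<le>degree p. monom (coeff p i) (Suc i))"
  proof (rule poly_eqI)
    fix k
    show "coeff (pCons 0 p) k = coeff (\<Sum>i\<le>degree p. monom (coeff p i) (Suc i)) k"
      by (cases k) (simp_all add: coeff_sum coeff_eq_0)
  qed
  then have "gauss_E (pCons 0 p) = (\<Sum>i\<le>degree p. gauss_E (monom (coeff p i) (Suc i)))"
    by (simp add: gauss_E_sum)
  also have "\<dots> = (\<Sum>i\<le>degree p. gauss_E (pderiv (monom (coeff p i) i)))"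
  proof (intro sum.cong refl)
    fix i
    have "gauss_E (monom (coeff p i) (Suc i)) = coeff p i * gauss_E (pderiv (monom 1 i))"
      by (subst gauss_E_monom) (simp add: gauss_E_monom_Suc)
    also have "\<dots> = gauss_E (pderiv (monom (coeff p i) i))"
      by (simp add: smult_monom mult.commute flip: gauss_E_smult pderiv_smult)
    finally show "gauss_E (monom (coeff p i) (Suc i)) = gauss_E (pderiv (monom (coeff p i) i))" .
  qed
  also have "\<dots> = gauss_E (pderiv (\<Sum>i\<le>degree p. monom (coeff p i) i))"
    using higher_pderiv_sum[of 1 "\<lambda>i. monom (coeff p i) i"] by (simp add: gauss_E_sum)
  also have "\<dots> = gauss_E (pderiv p)"
    by (simp only: poly_as_sum_of_monoms)
  finally show ?thesis .
qed

lemma gauss_E_hermite_mult: "gauss_E (hermite_p n * q) = gauss_E ((pderiv ^^ n) q)"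
proof (induction n arbitrary: q)
  case (Suc n)
  have "gauss_E (hermite_p (Suc n) * q) =
      gauss_E (pCons 0 (hermite_p n * q)) - gauss_E (pderiv (hermite_p n) * q)"
    by (simp add: left_diff_distrib gauss_E_diff)
  \<comment> \<open>Stein's identity and the product rule give two terms; the one with
    \<open>pderiv (hermite_p n)\<close> cancels.\<close>
  also have "\<dots> = gauss_E (hermite_p n * pderiv q)"
    by (simp add: stein_identity pderiv_mult gauss_E_add mult.commute)
  also have "\<dots> = gauss_E ((pderiv ^^ Suc n) q)"
    by (simp only: Suc funpow_Suc_right o_apply)
  finally show ?case .
qed simp

lemma hermite_orthogonal:
  "gauss_E (hermite_p m * hermite_p n) = (if m = n then fact n else 0)"
proof -
  \<comment> \<open>By symmetry the larger index can supply the derivatives. They kill a factor of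
    smaller degree and send a monic one of degree \<open>n\<close> to \<open>fact n\<close>.\<close>
  have le: "gauss_E (hermite_p n * hermite_p m) = (if m = n then fact n else 0)" if "m \<le> n" for m n
  proof -
    have "degree (hermite_p m) \<le> n"
      using degree_hermite_p_le[of m] that by linarith
    moreover have "coeff (hermite_p m) n = 0" if "m < n"
      using degree_hermite_p_le[of m] that by (intro coeff_eq_0) linarith
    ultimately show ?thesis
      using that by (auto simp: gauss_E_hermite_mult higher_pderiv_degree_le gauss_E_const
          coeff_hermite_p_self)
  qed
  show ?thesis
    using le[of m n] le[of n m] by (cases "m \<le> n") (auto simp: mult.commute)
qed

text \<open>This is the scaling of \<open>s\<close> to a standard normal variable, done by comparing
  closed forms of the moments.\<close>

lemma expectation_normal_even_power:
  assumes "distributed P lborel s (normal_density 0 \<sigma>)" "\<sigma> > 0"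
  shows "prob_space.expectation P (\<lambda>\<omega>. s \<omega> ^ (2 * k)) = \<sigma> ^ (2 * k) * gauss_E (monom 1 (2 * k))"
proof -
  have "prob_space.expectation P (\<lambda>\<omega>. s \<omega> ^ (2 * k)) =
      (\<integral>x. normal_density 0 \<sigma> x * x ^ (2 * k) \<partial>lborel)"
    by (rule distributed_integral[OF assms(1), symmetric]) auto
  also have "\<dots> = fact (2 * k) / ((2 / \<sigma>\<^sup>2) ^ k * fact k)"
    using integral_normal_moment_even[OF assms(2), of 0 k] by simp
  finally show ?thesis
    using assms(2) by (simp add: gauss_E_monom_even power_divide power_mult)
qed

subsection \<open>Coefficient matrices\<close>

lemma hermite_p_eq_sum:
  assumes "2 * i + e < 2 * M" "e \<le> 1"
  shows "hermite_p (2 * i + e) = (\<Sum>k<M. monom (hermite_vec M (2 * i + e) $ k) (2 * k + e))"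
proof -
  let ?v = "hermite_vec M (2 * i + e)"
  \<comment> \<open>\<open>hermite_vec\<close> is a definite description, so its defining identity
    needs existence and uniqueness, hence the index bound.\<close>
  have v: "is_hermite_vec M (2 * i + e) ?v"
    unfolding hermite_vec_def by (rule theI'[OF ex1_hermite_vec[OF assms(1)]])
  have "poly (hermite_p (2 * i + e)) x = poly (\<Sum>k<M. monom (?v $ k) (2 * k + e)) x" for x
  proof -
    have "poly (hermite_p (2 * i + e)) x = x ^ e * (?v \<bullet> even_powers M x)"
      using v assms(2) by (cases "e = 0") (auto simp: is_hermite_vec_def hermite_eq_poly le_Suc_eq)
    also have "\<dots> = poly (\<Sum>k<M. monom (?v $ k) (2 * k + e)) x"
      by (simp add: even_powers_def scalar_prod_def poly_sum poly_monom power_add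
          sum_distrib_left mult_ac atLeast0LessThan)
    finally show ?thesis .
  qed
  then show "hermite_p (2 * i + e) = (\<Sum>k<M. monom (?v $ k) (2 * k + e))"
    by (simp flip: poly_eq_poly_eq_iff add: fun_eq_iff)
qed

lemma hermite_vec_nth_eq_0:
  assumes "i < k" "k < M" "e \<le> 1"
  shows "hermite_vec M (2 * i + e) $ k = 0"
proof -
  have "hermite_vec M (2 * i + e) $ k = coeff (hermite_p (2 * i + e)) (2 * k + e)"
    using assms by (subst hermite_p_eq_sum[of i e M]) (auto simp: coeff_sum)
  also have "\<dots> = 0"
    using degree_hermite_p_le[of "2 * i + e"] assms(1) by (intro coeff_eq_0) linarith
  finally show ?thesis .
qed

lemma the_mat_inverse:
  assumes "A \<in> carrier_mat n n" "C \<in> carrier_mat n n" "A * C = 1\<^sub>m n" "C * A = 1\<^sub>m n"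
  shows "the (mat_inverse A) = C"
proof -
  \<comment> \<open>Being a unit rules out the result \<open>None\<close>; uniqueness of inverses
    then identifies the matrix returned.\<close>
  have "A \<in> Units (ring_mat TYPE('a :: field) n ())"
    using assms by (auto simp: Units_def ring_mat_def)
  then obtain B where B: "mat_inverse A = Some B"
    using mat_inverse(1)[OF assms(1), where b = "()"] by (cases "mat_inverse A") auto
  have AB: "A * B = 1\<^sub>m n" "B \<in> carrier_mat n n"
    using mat_inverse(2)[OF assms(1) B] by auto
  have "B = C * A * B"
    using AB(2) assms(4) by simp
  also have "\<dots> = C"
    using assoc_mult_mat[OF assms(2,1) AB(2)] AB(1) assms(2) by simp
  finally show ?thesis using B by simp
qed

lemma mat_inverse_mat_diag:
  fixes f :: "nat \<Rightarrow> 'a :: field"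
  assumes "\<And>i. f i \<noteq> 0"
  shows "the (mat_inverse (mat_diag n f)) = mat_diag n (\<lambda>i. inverse (f i))"
  using assms by (intro the_mat_inverse) auto

text \<open>The offset \<open>e\<close> selects the parity: \<open>e = 0\<close> gives \<open>L\<^sub>a\<close> and \<open>A\<close>, \<open>e = 1\<close> gives \<open>L\<^sub>b\<close> and \<open>B\<close>.\<close>

definition hermite_mat :: "nat \<Rightarrow> nat \<Rightarrow> real mat" where
  "hermite_mat e M = mat M M (\<lambda>(i, k). hermite_vec M (2 * i + e) $ k)"

lemma upper_triangular_transpose_hermite_mat:
  "e \<le> 1 \<Longrightarrow> upper_triangular (transpose_mat (hermite_mat e M))"
  by (auto simp: hermite_mat_def hermite_vec_nth_eq_0)

lemma mat_of_rows_hermite_vec: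
  assumes "\<And>i. i < M \<Longrightarrow> h (Suc i) = 2 * i + e"
  shows "mat_of_rows M (map (\<lambda>m. hermite_vec M (h m)) [1..<M + 1]) = hermite_mat e M"
proof (rule eq_matI)
  fix i j assume "i < dim_row (hermite_mat e M)" "j < dim_col (hermite_mat e M)"
  then show "mat_of_rows M (map (\<lambda>m. hermite_vec M (h m)) [1..<M + 1]) $$ (i, j) =
      hermite_mat e M $$ (i, j)"
    using assms by (simp add: hermite_mat_def mat_of_rows_def nth_append del: upt_Suc)
qed (simp_all add: hermite_mat_def)

text \<open>The two factors \<open>S\<close> cancel all powers of \<open>\<sigma>\<close> that
  depend on the row or column of \<open>X\<close>, leaving \<open>\<sigma> ^ (2 * e)\<close> times a
  matrix of standard normal moments. Its congruence by the coefficient matrix is the Gram matrix of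
  Hermite polynomials of one parity, which is diagonal.\<close>

lemma hermite_mat_congruence:
  fixes \<sigma> :: real
  assumes "\<sigma> \<noteq> 0" "e \<le> 1"
    and X: "X = mat M M (\<lambda>(i, j). \<sigma> ^ (2 * (i + j + e)) * gauss_E (monom 1 (2 * (i + j + e))))"
    and S: "S = mat_diag M (\<lambda>i. inverse (\<sigma> ^ (2 * i)))"
  shows "hermite_mat e M * S * X * S * transpose_mat (hermite_mat e M) =
    \<sigma> ^ (2 * e) \<cdot>\<^sub>m mat_diag M (\<lambda>i. fact (2 * i + e))"
proof -
  let ?L = "hermite_mat e M"
  let ?b = "\<lambda>i k. hermite_vec M (2 * i + e) $ k"
  let ?\<mu> = "\<lambda>k l. gauss_E (monom 1 (2 * (k + l + e)))"
  have L: "?L \<in> carrier_mat M M" by (simp add: hermite_mat_def)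
  have LS: "?L * S = mat M M (\<lambda>(i, k). ?b i k * inverse (\<sigma> ^ (2 * k)))"
    unfolding S mat_diag_mult_right[OF L] by (auto simp: hermite_mat_def)
  have LSX: "?L * S * X =
      mat M M (\<lambda>(i, l). \<Sum>k<M. ?b i k * \<sigma> ^ (2 * l + 2 * e) * ?\<mu> k l)"
    unfolding LS X using assms(1)
    by (auto simp: scalar_prod_def atLeast0LessThan power_add distrib_left intro!: eq_matI sum.cong)
  have LSX_carrier: "?L * S * X \<in> carrier_mat M M" unfolding LSX by simp
  have LSXS: "?L * S * X * S = mat M M (\<lambda>(i, l). \<sigma> ^ (2 * e) * (\<Sum>k<M. ?b i k * ?\<mu> k l))"
    unfolding S mat_diag_mult_right[OF LSX_carrier[unfolded S]]
    unfolding LSX[unfolded S] using assms(1)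
    by (auto simp: sum_distrib_left sum_distrib_right power_add intro!: eq_matI sum.cong)
  \<comment> \<open>The double sum expands the expectation of a product of two Hermite polynomials
    in monomials.\<close>
  have entry: "(\<Sum>l<M. (\<Sum>k<M. ?b i k * ?\<mu> k l) * ?b j l) = (if i = j then fact (2 * j + e) else 0)"
    if "i < M" "j < M" for i j
  proof -
    have lt: "2 * i + e < 2 * M" "2 * j + e < 2 * M" using that assms(2) by linarith+
    have "(\<Sum>l<M. (\<Sum>k<M. ?b i k * ?\<mu> k l) * ?b j l) =
        (\<Sum>l<M. \<Sum>k<M. gauss_E (monom (?b i k) (2 * k + e) * monom (?b j l) (2 * l + e)))"
      unfolding sum_distrib_right
    proof (intro sum.cong refl)
      fix k l
      have "2 * (k + l + e) = 2 * k + e + (2 * l + e)" by simp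
      then show "?b i k * ?\<mu> k l * ?b j l =
          gauss_E (monom (?b i k) (2 * k + e) * monom (?b j l) (2 * l + e))"
        by (simp only: mult_monom gauss_E_monom[of "_ * _"] mult_ac)
    qed
    also have "\<dots> = gauss_E (hermite_p (2 * i + e) * hermite_p (2 * j + e))"
      unfolding hermite_p_eq_sum[OF lt(1) assms(2)] hermite_p_eq_sum[OF lt(2) assms(2)]
        sum_product gauss_E_sum by (rule sum.swap)
    finally show ?thesis by (simp add: hermite_orthogonal)
  qed
  show ?thesis
    unfolding LSXS
    by (rule eq_matI)
       (auto simp: hermite_mat_def mat_diag_def scalar_prod_def atLeast0LessThan mult.assoc entry
         simp del: distrib_left_numeral simp flip: sum_distrib_left)
qed

theorem lemma1:
  fixes P :: "'a measure" and s :: "'a \<Rightarrow> real" and \<sigma> :: real and M :: nat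
    and A B D D\<sigma> La Lb Da Db :: "real mat"
  assumes "M \<ge> 1" and "\<sigma> > 0"
    and "prob_space P" and "distributed P lborel s (normal_density 0 \<sigma>)"
    and "A = mat M M (\<lambda>(i, j). prob_space.expectation P (\<lambda>\<omega>. s \<omega> ^ (2 * (i + j))))"
    and "B = mat M M (\<lambda>(i, j). prob_space.expectation P (\<lambda>\<omega>. s \<omega> ^ (2 * (i + j + 1))))"
    and "D = mat_diag M (\<lambda>i. real (2 * i + 1))"
    and "D\<sigma> = mat_diag M (\<lambda>i. \<sigma> ^ (2 * i))"
    and "Lb = mat_of_rows M (map (\<lambda>m. hermite_vec M (2 * m - 1)) [1..<M + 1])"
    and "La = mat_of_rows M (map (\<lambda>m. hermite_vec M (2 * m - 2)) [1..<M + 1])"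
    and "Da = mat_diag M (\<lambda>i. fact (2 * i))"
    and "Db = mat_diag M (\<lambda>i. fact (2 * i + 1))"
  shows "upper_triangular (transpose_mat Lb) \<and> upper_triangular (transpose_mat La) \<and>
    Lb * the (mat_inverse D\<sigma>) * B * the (mat_inverse D\<sigma>) * transpose_mat Lb = \<sigma>\<^sup>2 \<cdot>\<^sub>m Db \<and>
    La * the (mat_inverse D\<sigma>) * A * the (mat_inverse D\<sigma>) * transpose_mat La = Da \<and>
    Db = D * Da"
proof -
  have inv: "the (mat_inverse D\<sigma>) = mat_diag M (\<lambda>i. inverse (\<sigma> ^ (2 * i)))"
    unfolding assms(8) using assms(2) by (intro mat_inverse_mat_diag) simp
  note moment = expectation_normal_even_power[OF assms(4,2)]
  have La: "La = hermite_mat 0 M" and Lb: "Lb = hermite_mat 1 M"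
    unfolding assms(9,10) by (rule mat_of_rows_hermite_vec; simp)+
  \<comment> \<open>Here \<open>e = 1\<close>, so the remaining factor is \<open>\<sigma>^2\<close>;
    for \<open>La\<close> it is \<open>1\<close>.\<close>
  have "Lb * the (mat_inverse D\<sigma>) * B * the (mat_inverse D\<sigma>) * transpose_mat Lb = \<sigma>\<^sup>2 \<cdot>\<^sub>m Db"
    unfolding Lb inv assms(6,12) moment using assms(2) by (subst hermite_mat_congruence) auto
  moreover have "La * the (mat_inverse D\<sigma>) * A * the (mat_inverse D\<sigma>) * transpose_mat La = Da"
    unfolding La inv assms(5,11) moment using assms(2) by (subst hermite_mat_congruence) auto
  moreover have "Db = D * Da"
    unfolding assms(7,11,12) by simp
  ultimately show ?thesis
    unfolding La Lb by (simp add: upper_triangular_transpose_hermite_mat)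
qed

end
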